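(* The number $\mathrm{RII}(P)$ is an invariant of knot projections under (1, 3) homotopy: if $P$ and $P'$ are knot projections that are (1, 3) homotopic, then $\mathrm{RII}(P) = \mathrm{RII}(P')$.
   Context: A knot projection is the image of a generic immersion of a circle into the $2$-sphere $S^2$ (the only self-intersections are finitely many transverse double points). Knot projections are considered up to ambient isotopy of $S^2$. The trivial spherical curve is the knot projection with no double points. Deformations (analogues, for curves without over/under information, of the Reidemeister moves). Type 1: locally create or delete a $1$-gon (a small kink containing one double point). Type 2: locally create or delete an empty $2$-gon (bigon) formed by two arcs crossing in two double points. Type 3: for an empty $3$-gon formed by three arcs, move one of the arcs across the double point of the other two. A deformation of negative type 2 is a type 2 deformation that deletes a bigon (decreasing the number of double points by $2$). Type 1 deformations may be performed in both directions. Two knot projections are (1, 3) homotopic if they are related by a finite sequence of deformations of types 1 and 3 and ambient isotopies; this is an equivalence relation, called (1, 3) homotopy. It is known that every knot projection can be transformed into the trivial spherical curve by a finite sequence of deformations of type 1, negative type 2, and type 3 (and ambient isotopies). $\mathrm{RII}(P)$ is the minimum, over all such finite sequences from $P$ to the trivial spherical curve, of the number of negative type 2 deformations in the sequence. *)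

theory Defs
  imports "HOL-Analysis.Analysis"
begin

abbreviation S2 :: "(real^3) set" where
  "S2 \<equiv> sphere 0 1"

section \<open>Knot projections\<close>

definition smooth_curve :: "(real \<Rightarrow> 'a::real_normed_vector) \<Rightarrow> bool" where
  "smooth_curve g \<longleftrightarrow>
     (\<exists>D. D 0 = g \<and> (\<forall>n t. (D n has_vector_derivative D (Suc n) t) (at t)))"

text \<open>
  The circle is the unit circle of the complex plane; a map \<open>f\<close> on it is differentiated through
  its lift \<open>f \<circ> cis\<close> to the real line.
\<close>

definition velocity :: "(complex \<Rightarrow> real^3) \<Rightarrow> real \<Rightarrow> real^3" where
  "velocity f t = vector_derivative (f \<circ> cis) (at t)"

definition circle_immersion :: "(complex \<Rightarrow> real^3) \<Rightarrow> bool" where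
  "circle_immersion f \<longleftrightarrow>
     f ` sphere 0 1 \<subseteq> S2 \<and> smooth_curve (f \<circ> cis) \<and> (\<forall>t. velocity f t \<noteq> 0)"

definition multiple_points :: "(complex \<Rightarrow> real^3) \<Rightarrow> (real^3) set" where
  "multiple_points f =
     {p. \<exists>z\<in>sphere 0 1. \<exists>w\<in>sphere 0 1. z \<noteq> w \<and> f z = p \<and> f w = p}"

text \<open>
  Transversality is linear independence of the two velocities, expressed by \<open>collinear\<close>
  (\<open>independent {v, w}\<close> would wrongly accept \<open>v = w\<close>).
\<close>

definition generic_immersion :: "(complex \<Rightarrow> real^3) \<Rightarrow> bool" where
  "generic_immersion f \<longleftrightarrow>
     circle_immersion f \<and>
     finite (multiple_points f) \<and>
     (\<forall>p\<in>multiple_points f. card {z \<in> sphere 0 1. f z = p} = 2) \<and>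
     (\<forall>s t. cis s \<noteq> cis t \<and> f (cis s) = f (cis t) \<longrightarrow>
        \<not> collinear {0, velocity f s, velocity f t})"

definition knot_projection :: "(real^3) set \<Rightarrow> bool" where
  "knot_projection P \<longleftrightarrow> (\<exists>f. generic_immersion f \<and> f ` sphere 0 1 = P)"

definition trivial_curve :: "(real^3) set \<Rightarrow> bool" where
  "trivial_curve P \<longleftrightarrow>
     (\<exists>f. generic_immersion f \<and> multiple_points f = {} \<and> f ` sphere 0 1 = P)"

text \<open>
  Ambient isotopy is taken in the topological sense: a path of self-homeomorphisms of the sphere
  that starts at the identity.
\<close>

definition ambient_isotopic :: "(real^3) set \<Rightarrow> (real^3) set \<Rightarrow> bool" where
  "ambient_isotopic P Q \<longleftrightarrow>
     (\<exists>h. homotopic_with_canon (\<lambda>k. \<exists>k'. homeomorphism S2 S2 k k') S2 S2 id h \<and> h ` P = Q)"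

section \<open>Deformations\<close>

text \<open>
  A deformation replaces the part of the curve inside a closed disc of the sphere.  The disc is
  the homeomorphic image of the following square, in which the two local pictures are drawn.
  Because the chart need not be smooth, the pictures matter only up to homeomorphism; the two
  pictures of one deformation meet the boundary of the square in the same points.
\<close>

definition square :: "(real \<times> real) set" where
  "square = {-1..1} \<times> {-1..1}"

definition local_move ::
  "(real \<times> real) set \<Rightarrow> (real \<times> real) set \<Rightarrow> (real^3) set \<Rightarrow> (real^3) set \<Rightarrow> bool" where
  "local_move A B P Q \<longleftrightarrow>
     (\<exists>D \<phi> \<psi>. D \<subseteq> S2 \<and> homeomorphism square D \<phi> \<psi> \<and>
        P - D = Q - D \<and> P \<inter> D = \<phi> ` A \<and> Q \<inter> D = \<phi> ` B)"

text \<open>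
  Type 1: the arc is a parabola; the kink is a nodal cubic, parametrised by
  \<open>y = t\<^sup>2 - 1/2\<close>, \<open>x = t y / 2\<close>, with its double point at the origin and its loop (the 1-gon) below.
  Both join the same two points of the top edge.
\<close>

definition arc_picture :: "(real \<times> real) set" where
  "arc_picture = {(x, y) \<in> square. 8 * x\<^sup>2 = 2 * y + 1}"

definition kink_picture :: "(real \<times> real) set" where
  "kink_picture = {(x, y) \<in> square. 8 * x\<^sup>2 = y\<^sup>2 * (2 * y + 1)}"

text \<open>
  Type 2: the two arcs of the bigon cross at \<open>x\<^sup>2 = 1/2\<close>; each has the same endpoints as one of
  the two parallel arcs.
\<close>

definition parallel_picture :: "(real \<times> real) set" where
  "parallel_picture = {(x, y) \<in> square. y = 1/2 \<or> y = - 1/2}"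

definition bigon_picture :: "(real \<times> real) set" where
  "bigon_picture = {(x, y) \<in> square. y = x\<^sup>2 - 1/2 \<or> y = 1/2 - x\<^sup>2}"

text \<open>
  Type 3: the two diagonals cross at the origin, and the third arc passes above it (\<open>\<epsilon> = 1\<close>) or
  below it (\<open>\<epsilon> = -1\<close>), meeting each diagonal once.
\<close>

definition triangle_picture :: "real \<Rightarrow> (real \<times> real) set" where
  "triangle_picture \<epsilon> = {(x, y) \<in> square. y = x \<or> y = - x \<or> y = \<epsilon> * (1 - x\<^sup>2) / 2}"

datatype deformation = Isotopy | Type1 | NegType2 | Type3

fun related_by :: "deformation \<Rightarrow> (real^3) set \<Rightarrow> (real^3) set \<Rightarrow> bool" where
  "related_by Isotopy = ambient_isotopic"
| "related_by Type1 = symclp (local_move arc_picture kink_picture)"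
| "related_by NegType2 = local_move bigon_picture parallel_picture"
| "related_by Type3 = symclp (local_move (triangle_picture 1) (triangle_picture (-1)))"

inductive deformation_sequence ::
  "(real^3) set \<Rightarrow> deformation list \<Rightarrow> (real^3) set \<Rightarrow> bool" where
  Nil: "knot_projection P \<Longrightarrow> deformation_sequence P [] P"
| Cons: "knot_projection P \<Longrightarrow> related_by d P Q \<Longrightarrow> deformation_sequence Q ds R \<Longrightarrow>
         deformation_sequence P (d # ds) R"

definition homotopic_13 :: "(real^3) set \<Rightarrow> (real^3) set \<Rightarrow> bool" where
  "homotopic_13 P Q \<longleftrightarrow>
     (\<exists>ds. set ds \<subseteq> {Isotopy, Type1, Type3} \<and> deformation_sequence P ds Q)"

text \<open>
  Any simple curve may serve as the end of the sequence: all of them are ambient isotopic.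
  The minimum is over a nonempty set, since every knot projection can be so deformed into a
  simple curve.
\<close>

definition RII :: "(real^3) set \<Rightarrow> nat" where
  "RII P = (LEAST n. \<exists>ds T. trivial_curve T \<and> deformation_sequence P ds T \<and>
                       n = count_list ds NegType2)"

end

theory Submission imports Defs begin

text \<open>
  Deformations of types 1 and 3 and ambient isotopies can be undone, so a (1, 3) homotopy from
  \<open>P\<close> to \<open>P'\<close> can be put in front of any sequence starting at \<open>P'\<close>, and its reversal in front of
  any sequence starting at \<open>P\<close>, without changing the number of negative type 2 deformations.
\<close>

lemma ambient_isotopic_sym:
  assumes "ambient_isotopic P Q" and "P \<subseteq> S2"
  shows "ambient_isotopic Q P"
proof -
  let ?homeo = "\<lambda>k. \<exists>k'. homeomorphism S2 S2 k k'"
  obtain h where h: "homotopic_with_canon ?homeo S2 S2 id h" and hP: "h ` P = Q"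
    using assms(1) unfolding ambient_isotopic_def by blast
  obtain k where hk: "homeomorphism S2 S2 h k"
    using homotopic_with_imp_property[OF h] by auto
  have kh: "homeomorphism S2 S2 k h"
    using hk by (rule homeomorphism_symD)
  have comp: "?homeo (f \<circ> k)" if "?homeo f" for f
    using that homeomorphism_compose[OF kh] by blast
  txt \<open>Running \<open>H\<^sub>t \<circ> h\<^sup>-\<^sup>1\<close> backwards avoids inverting the intermediate homeomorphisms \<open>H\<^sub>t\<close>.\<close>
  have "homotopic_with_canon ?homeo S2 S2 (id \<circ> k) (h \<circ> k)"
  proof (rule homotopic_with_compose_continuous_right)
    show "homotopic_with_canon (\<lambda>f. ?homeo (f \<circ> k)) S2 S2 id h"
      using h comp by (rule homotopic_with_mono)
    show "continuous_on S2 k" and "k \<in> S2 \<rightarrow> S2"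
      using homeomorphism_cont1[OF kh] homeomorphism_image1[OF kh] by blast+
  qed
  then have "homotopic_with_canon ?homeo S2 S2 (h \<circ> k) (id \<circ> k)"
    by (rule homotopic_with_symD)
  \<comment> \<open>\<open>h \<circ> k\<close> is the identity only on \<open>S2\<close>. This
    suffices to exchange the end maps, because being a homeomorphism of \<open>S2\<close> depends
    only on the values there.\<close>
  then have "homotopic_with_canon ?homeo S2 S2 id k"
  proof (rule homotopic_with_eq)
    show "?homeo f = ?homeo g" if "\<And>x. x \<in> topspace (top_of_set S2) \<Longrightarrow> f x = g x" for f g
    proof -
      have "\<And>x. x \<in> S2 \<Longrightarrow> f x = g x" using that by simp
      then show ?thesis
        by (metis (no_types) homeomorphism_cong[OF _ refl refl _ refl])
    qed
  qed (simp_all add: homeomorphism_apply2[OF hk])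
  \<comment> \<open>\<open>k\<close> undoes \<open>h\<close> only on the sphere, so
    \<open>P \<subseteq> S2\<close> enters here.\<close>
  moreover have "k ` Q = P"
    unfolding hP[symmetric] image_image
    using homeomorphism_apply1[OF hk] subsetD[OF assms(2)] by (metis image_cong image_ident)
  ultimately show ?thesis
    unfolding ambient_isotopic_def by blast
qed

lemma knot_projection_subset: "knot_projection P \<Longrightarrow> P \<subseteq> S2"
  unfolding knot_projection_def generic_immersion_def circle_immersion_def by blast

text \<open>Types 1 and 3 are symmetric closures by definition; only for isotopies is there
  something to show, and there \<open>P\<close> must lie on the sphere.\<close>

lemma related_by_sym:
  assumes "d \<noteq> NegType2" and "related_by d P Q" and "knot_projection P"
  shows "related_by d Q P"
  using assms ambient_isotopic_sym[OF _ knot_projection_subset[OF assms(3)]]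
  by (cases d) (auto simp: symclp_def)

lemma deformation_sequence_start:
  "deformation_sequence P ds Q \<Longrightarrow> knot_projection P"
  by (cases rule: deformation_sequence.cases)

lemma deformation_sequence_append:
  assumes "deformation_sequence P ds Q" and "deformation_sequence Q es R"
  shows "deformation_sequence P (ds @ es) R"
  using assms by induction (auto intro: deformation_sequence.Cons)

text \<open>The tail is reversed first and the inverted first step is appended as a one-step
  sequence, matching \<open>rev (d # ds) = rev ds @ [d]\<close>.\<close>

lemma deformation_sequence_rev:
  assumes "deformation_sequence P ds Q" and "NegType2 \<notin> set ds"
  shows "deformation_sequence Q (rev ds) P"
  using assms
proof induction
  case (Nil P)
  then show ?case by (auto intro: deformation_sequence.Nil)
next
  case (Cons P d Q ds R)
  \<comment> \<open>The inverted step starts at \<open>Q\<close>; the tail, which also starts there,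
    certifies that \<open>Q\<close> is a knot projection.\<close>
  have Q: "knot_projection Q"
    using Cons.hyps(3) by (rule deformation_sequence_start)
  have "related_by d Q P"
    using Cons.hyps(1,2) Cons.prems related_by_sym[of d P Q] by auto
  then have "deformation_sequence Q [d] P"
    using deformation_sequence.Cons[OF Q _ deformation_sequence.Nil[OF Cons.hyps(1)]] by simp
  moreover have "deformation_sequence R (rev ds) Q"
    using Cons.IH Cons.prems by simp
  ultimately show ?case
    using deformation_sequence_append by simp
qed

lemma homotopic_13_sym:
  assumes "homotopic_13 P Q"
  shows "homotopic_13 Q P"
proof -
  obtain ds where ds: "set ds \<subseteq> {Isotopy, Type1, Type3}" "deformation_sequence P ds Q"
    using assms unfolding homotopic_13_def by blast
  then have "deformation_sequence Q (rev ds) P"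
    by (intro deformation_sequence_rev) auto
  with ds(1) show ?thesis
    unfolding homotopic_13_def by (intro exI[of _ "rev ds"]) simp
qed

lemma homotopic_13_prepend:
  assumes "homotopic_13 P Q" and "deformation_sequence Q es T"
  shows "\<exists>ds. deformation_sequence P ds T \<and> count_list ds NegType2 = count_list es NegType2"
proof -
  obtain ds where ds: "set ds \<subseteq> {Isotopy, Type1, Type3}" "deformation_sequence P ds Q"
    using assms(1) unfolding homotopic_13_def by blast
  then have "count_list ds NegType2 = 0"
    by (auto simp: count_list_0_iff)
  then show ?thesis
    using deformation_sequence_append[OF ds(2) assms(2)] by (intro exI[of _ "ds @ es"]) simp
qed

theorem proposition1:
  fixes P P' :: "(real^3) set"
  assumes "knot_projection P" and "knot_projection P'"
    and "homotopic_13 P P'"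
  shows "RII P = RII P'"
proof -
  \<comment> \<open>Not only the minima but the whole sets of attainable counts agree, so the two
    predicates under \<open>LEAST\<close> are equivalent for each \<open>n\<close>.\<close>
  have "(\<exists>ds T. trivial_curve T \<and> deformation_sequence P ds T \<and> n = count_list ds NegType2) \<longleftrightarrow>
        (\<exists>ds T. trivial_curve T \<and> deformation_sequence P' ds T \<and> n = count_list ds NegType2)" for n
    using homotopic_13_prepend[OF assms(3)]
      homotopic_13_prepend[OF homotopic_13_sym[OF assms(3)]]
    by metis
  then show ?thesis
    unfolding RII_def by simp
qed

end
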